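(* Let $T\subset\mathbb{R}^2$ be a convex polygon (compact, with non-empty interior), and let $c$ be a regular $3$-bounce billiard orbit on $T$. Let $e_1,e_2,e_3$ be the edges of $T$ hit by $c$ (enumerated counterclockwise), and denote by $\overline{e}_i$ the line supporting $e_i$. Then the lines $\overline{e}_1,\overline{e}_2,\overline{e}_3$ cut out an acute triangle $\Delta$ containing $T$, and the trace of $c$ is the Fagnano triangle of $\Delta$.
   Context: An outward support vector of $T$ at $q\in\partial T$ is a vector $\nu$ with $\langle x-q,\nu\rangle\le0$ for all $x\in T$. A point $q\in\partial T$ is smooth if there is a unique line through $q$ disjoint from the interior of $T$. A generalised billiard orbit on $T$ is a sequence $q_i\in\partial T$, $i\in\mathbb{Z}$ (consecutive points distinct), such that for every $i$ the vector $\frac{q_i-q_{i-1}}{\|q_i-q_{i-1}\|}+\frac{q_i-q_{i+1}}{\|q_i-q_{i+1}\|}$ is an outward support vector of $T$ at $q_i$; it is regular if all the points $q_i$ (bounce points) are smooth. It is closed if $q_{i+n}=q_i$ for all $i$ for some $n\ge2$, and an $n$-bounce orbit if $n$ is the smallest such integer. A triangle is acute if all its angles are $<\frac{\pi}{2}$. The Fagnano triangle of an acute triangle is the triangle whose vertices are the feet of its three altitudes. *)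

theory Defs
  imports "HOL-Analysis.Analysis"
begin

section \<open>Smooth points and generalised billiard orbits\<close>

definition outward_support_vector :: "(real^2) set \<Rightarrow> real^2 \<Rightarrow> real^2 \<Rightarrow> bool" where
  "outward_support_vector T q \<nu> \<longleftrightarrow> q \<in> frontier T \<and> (\<forall>x\<in>T. (x - q) \<bullet> \<nu> \<le> 0)"

definition is_line :: "(real^2) set \<Rightarrow> bool" where
  "is_line l \<longleftrightarrow> affine l \<and> aff_dim l = 1"

definition smooth_point :: "(real^2) set \<Rightarrow> real^2 \<Rightarrow> bool" where
  "smooth_point T q \<longleftrightarrow> q \<in> frontier T \<and> (\<exists>!l. is_line l \<and> q \<in> l \<and> l \<inter> interior T = {})"

text \<open>As the zero vector is an outward support vector, an orbit may pass straight through a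
  boundary point.\<close>

definition generalised_billiard_orbit :: "(real^2) set \<Rightarrow> (int \<Rightarrow> real^2) \<Rightarrow> bool" where
  "generalised_billiard_orbit T q \<longleftrightarrow>
     (\<forall>i. q i \<in> frontier T) \<and>
     (\<forall>i. q i \<noteq> q (i + 1)) \<and>
     (\<forall>i. outward_support_vector T (q i)
            ((q i - q (i - 1)) /\<^sub>R norm (q i - q (i - 1)) +
             (q i - q (i + 1)) /\<^sub>R norm (q i - q (i + 1))))"

definition regular_billiard_orbit :: "(real^2) set \<Rightarrow> (int \<Rightarrow> real^2) \<Rightarrow> bool" where
  "regular_billiard_orbit T q \<longleftrightarrow>
     generalised_billiard_orbit T q \<and> (\<forall>i. smooth_point T (q i))"

definition closes_after :: "(int \<Rightarrow> real^2) \<Rightarrow> nat \<Rightarrow> bool" where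
  "closes_after q n \<longleftrightarrow> n \<ge> 2 \<and> (\<forall>i. q (i + int n) = q i)"

definition bounce_orbit :: "nat \<Rightarrow> (real^2) set \<Rightarrow> (int \<Rightarrow> real^2) \<Rightarrow> bool" where
  "bounce_orbit n T q \<longleftrightarrow>
     generalised_billiard_orbit T q \<and> closes_after q n \<and> (\<forall>m. closes_after q m \<longrightarrow> n \<le> m)"

definition orbit_trace :: "(int \<Rightarrow> real^2) \<Rightarrow> (real^2) set" where
  "orbit_trace q = (\<Union>i. closed_segment (q i) (q (i + 1)))"

section \<open>The edges hit by an orbit\<close>

definition edges_hit :: "(real^2) set \<Rightarrow> (int \<Rightarrow> real^2) \<Rightarrow> (real^2) set set" where
  "edges_hit T q = {e. e edge_of T \<and> (\<exists>i. q i \<in> e)}"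

text \<open>Twice the signed area of the triangle \<open>x y z\<close>; positive iff \<open>x, y, z\<close> are in
  counterclockwise order.\<close>

definition signed_area2 :: "real^2 \<Rightarrow> real^2 \<Rightarrow> real^2 \<Rightarrow> real" where
  "signed_area2 x y z = (y$1 - x$1) * (z$2 - x$2) - (y$2 - x$2) * (z$1 - x$1)"

text \<open>Points in the relative interiors of three distinct edges of a convex polygon are never
  collinear, and the orientation of such a triple does not depend on the points chosen.  Hence
  the following says that \<open>e1, e2, e3\<close> enumerate \<open>E\<close> in counterclockwise order along the
  boundary of the polygon.\<close>

definition ccw_enumeration ::
  "(real^2) set set \<Rightarrow> (real^2) set \<Rightarrow> (real^2) set \<Rightarrow> (real^2) set \<Rightarrow> bool" where
  "ccw_enumeration E e1 e2 e3 \<longleftrightarrow>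
     E = {e1, e2, e3} \<and> distinct [e1, e2, e3] \<and>
     (\<forall>x\<in>rel_interior e1. \<forall>y\<in>rel_interior e2. \<forall>z\<in>rel_interior e3. signed_area2 x y z > 0)"

section \<open>Triangles\<close>

definition lines_cut_out_triangle ::
  "(real^2) set \<Rightarrow> (real^2) set \<Rightarrow> (real^2) set \<Rightarrow> real^2 \<Rightarrow> real^2 \<Rightarrow> real^2 \<Rightarrow> bool" where
  "lines_cut_out_triangle l1 l2 l3 A B C \<longleftrightarrow>
     l2 \<inter> l3 = {A} \<and> l3 \<inter> l1 = {B} \<and> l1 \<inter> l2 = {C} \<and> \<not> collinear {A, B, C}"

text \<open>The angle at the middle point \<open>B\<close>.\<close>

definition triangle_angle :: "real^2 \<Rightarrow> real^2 \<Rightarrow> real^2 \<Rightarrow> real" where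
  "triangle_angle A B C = arccos (((A - B) \<bullet> (C - B)) / (norm (A - B) * norm (C - B)))"

definition acute_triangle :: "real^2 \<Rightarrow> real^2 \<Rightarrow> real^2 \<Rightarrow> bool" where
  "acute_triangle A B C \<longleftrightarrow>
     \<not> collinear {A, B, C} \<and>
     triangle_angle C A B < pi / 2 \<and>
     triangle_angle A B C < pi / 2 \<and>
     triangle_angle B C A < pi / 2"

text \<open>The foot of the altitude from \<open>A\<close> onto the line through \<open>B\<close> and \<open>C\<close>; the next lemma shows
  that it is well defined.\<close>

definition altitude_foot :: "real^2 \<Rightarrow> real^2 \<Rightarrow> real^2 \<Rightarrow> real^2" where
  "altitude_foot A B C = (THE D. D \<in> affine hull {B, C} \<and> orthogonal (A - D) (C - B))"

lemma altitude_foot_ex1: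
  fixes A B C :: "real^2"
  assumes "B \<noteq> C"
  shows "\<exists>!D. D \<in> affine hull {B, C} \<and> orthogonal (A - D) (C - B)"
proof -
  have pos: "(C - B) \<bullet> (C - B) \<noteq> 0" using assms by simp
  have mem: "D \<in> affine hull {B, C} \<longleftrightarrow> (\<exists>t. D = B + t *\<^sub>R (C - B))" for D
    by (auto simp: affine_hull_2_alt)
  have orth: "orthogonal (A - (B + t *\<^sub>R (C - B))) (C - B) \<longleftrightarrow>
      t = ((A - B) \<bullet> (C - B)) / ((C - B) \<bullet> (C - B))" for t
  proof -
    have "(A - (B + t *\<^sub>R (C - B))) \<bullet> (C - B) = (A - B) \<bullet> (C - B) - t * ((C - B) \<bullet> (C - B))"
      by (metis diff_diff_eq inner_diff_left inner_scaleR_left)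
    then show ?thesis using pos by (simp add: orthogonal_def eq_divide_eq)
      (metis)
  qed
  show ?thesis
    unfolding mem using orth by metis
qed

text \<open>The Fagnano triangle is taken as a closed polygonal curve, being compared with the trace
  of an orbit.\<close>

definition fagnano_triangle :: "real^2 \<Rightarrow> real^2 \<Rightarrow> real^2 \<Rightarrow> (real^2) set" where
  "fagnano_triangle A B C =
     (let D = altitude_foot A B C; E = altitude_foot B C A; F = altitude_foot C A B
      in closed_segment D E \<union> closed_segment E F \<union> closed_segment F D)"

end

theory Submission
  imports Defs
begin

text \<open>At a smooth point of a polygon there is only one supporting line, the one that carries the edge
  through that point.  So wherever the bounce vector is nonzero, its orthogonal line through the
  bounce point is the line of the edge that is hit.

  The three bounce points \<open>p, q, r\<close> are not collinear.  If one of them lay between the others, the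
  line of the three points would meet the boundary of \<open>T\<close> in an inner point of a chord and would be
  a supporting line.  At an end point of the chord the bounce vector is nonzero and parallel to this
  line, so the orthogonal line would be a second supporting line, against smoothness.

  For a non-collinear triple the bounce vector at \<open>p\<close> is the sum of the unit vectors from \<open>q\<close> and
  from \<open>r\<close> to \<open>p\<close>.  Hence the edge lines are the exterior bisectors of the triangle
  \<open>p q r\<close>, and they meet in its three excenters.  The rest is the classical fact that a triangle is
  the orthic triangle of its excentral triangle.  The excenter \<open>A\<close> opposite \<open>p\<close> lies on the interior
  bisector at \<open>p\<close>, which is orthogonal to the exterior one, so \<open>p\<close> is the foot of the altitude from
  \<open>A\<close>.  All three feet lie strictly between the vertices of their sides, which forces the angles to
  be acute.  Finally \<open>T\<close> lies in the three half-planes given by the bounce vectors, and their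
  intersection is the excentral triangle (\<open>excentral_triangle\<close>).

  Points chosen on the three sides of a triangle, vertices excluded, have the orientation of the
  triangle (\<open>signed_area2_points_on_sides\<close>).  As each edge hit is part of a side, one of the two
  cyclic orders of the edges is counterclockwise.  All that is claimed about the triangle is
  invariant under renaming the bounce points.\<close>

section \<open>Bounce vectors and excenters\<close>

definition perp_line :: "real^2 \<Rightarrow> real^2 \<Rightarrow> (real^2) set" where
  "perp_line q \<nu> = {x. (x - q) \<bullet> \<nu> = 0}"

text \<open>A normal of the mirror that reflects the ray from \<open>q\<close> to \<open>p\<close> into the ray
  from \<open>p\<close> to \<open>r\<close>; it vanishes when \<open>p\<close> lies strictly between \<open>q\<close> and \<open>r\<close>.\<close>

definition bounce_normal :: "real^2 \<Rightarrow> real^2 \<Rightarrow> real^2 \<Rightarrow> real^2" where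
  "bounce_normal p q r = (p - q) /\<^sub>R norm (p - q) + (p - r) /\<^sub>R norm (p - r)"

text \<open>The excenter opposite \<open>p\<close>, whose barycentric coordinates with respect to \<open>p, q, r\<close> are
  proportional to \<open>-a, b, c\<close> for the side lengths \<open>a, b, c\<close> opposite \<open>p, q, r\<close>.\<close>

definition excenter :: "real^2 \<Rightarrow> real^2 \<Rightarrow> real^2 \<Rightarrow> real^2" where
  "excenter p q r =
     (dist p r *\<^sub>R q + dist p q *\<^sub>R r - dist q r *\<^sub>R p) /\<^sub>R (dist p r + dist p q - dist q r)"

lemma perp_line_alt: "perp_line q \<nu> = {x. \<nu> \<bullet> x = \<nu> \<bullet> q}"
  by (auto simp: perp_line_def inner_diff_left inner_diff_right inner_commute)

lemma is_line_perp_line: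
  assumes "\<nu> \<noteq> 0"
  shows "is_line (perp_line q \<nu>)"
  using assms unfolding is_line_def perp_line_alt by (simp add: affine_hyperplane)

lemma self_mem_perp_line: "q \<in> perp_line q \<nu>"
  by (simp add: perp_line_def)

lemma bounce_normal_commute: "bounce_normal p q r = bounce_normal p r q"
  by (simp add: bounce_normal_def add.commute)

lemma excenter_commute: "excenter p q r = excenter p r q"
  by (simp add: excenter_def dist_commute add.commute)

section \<open>Smooth points of a polygon\<close>

lemma perp_line_disjoint_interior:
  assumes "outward_support_vector T q \<nu>" "\<nu> \<noteq> 0"
  shows "perp_line q \<nu> \<inter> interior T = {}"
proof -
  have "T \<subseteq> {x. \<nu> \<bullet> x \<le> \<nu> \<bullet> q}"
    using assms(1) by (auto simp: outward_support_vector_def inner_diff_right inner_commute)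
  then have "interior T \<subseteq> {x. \<nu> \<bullet> x < \<nu> \<bullet> q}"
    using interior_mono interior_halfspace_le[OF assms(2)] by metis
  then show ?thesis by (auto simp: perp_line_alt)
qed

lemma smooth_point_line_eq:
  assumes "smooth_point T q" "outward_support_vector T q \<nu>" "\<nu> \<noteq> 0"
    and "is_line l" "q \<in> l" "l \<inter> interior T = {}"
  shows "l = perp_line q \<nu>"
  using assms is_line_perp_line perp_line_disjoint_interior self_mem_perp_line
  unfolding smooth_point_def by metis

text \<open>The line of an edge through \<open>q\<close> misses the interior, and so does the line orthogonal to \<open>\<nu>\<close>;
  smoothness identifies them.  That some edge passes through \<open>q\<close> is the description of the frontier
  of a polyhedron as the union of its facets.\<close>

lemma smooth_point_edge:
  assumes T: "polytope T" "interior T \<noteq> {}"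
    and q: "smooth_point T q" "outward_support_vector T q \<nu>" "\<nu> \<noteq> 0"
  shows "e edge_of T \<and> q \<in> e \<longleftrightarrow> e = T \<inter> perp_line q \<nu>"
    and "affine hull (T \<inter> perp_line q \<nu>) = perp_line q \<nu>"
proof -
  have cvx: "convex T" using T polytope_imp_convex by blast
  have dimT: "aff_dim T = 2"
    using T(2) aff_dim_nonempty_interior[of T] by simp
  have edge: "affine hull f = perp_line q \<nu> \<and> f = T \<inter> perp_line q \<nu>"
    if f: "f edge_of T" "q \<in> f" for f
  proof -
    have face: "f face_of T" "aff_dim f = 1" using f by (auto simp: edge_of_def)
    have "f \<noteq> T" using face dimT by auto
    then have "affine hull f \<inter> interior T = {}"
      using affine_hull_face_of_disjoint_rel_interior[OF cvx face(1)] interior_subset_rel_interior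
      by blast
    moreover have "is_line (affine hull f)" using face by (simp add: is_line_def)
    moreover have "q \<in> affine hull f" using f hull_inc by metis
    ultimately have "affine hull f = perp_line q \<nu>" using smooth_point_line_eq q by blast
    then show ?thesis using face_of_imp_eq_affine_Int[OF cvx face(1)] by blast
  qed
  have "q \<in> rel_frontier T"
    using q(1) T(2) by (simp add: smooth_point_def rel_frontier_frontier affine_hull_nonempty_interior)
  then obtain F where F: "F facet_of T" "q \<in> F"
    using rel_frontier_of_polyhedron[OF polytope_imp_polyhedron[OF T(1)]] by blast
  then have Fe: "F edge_of T" using dimT by (auto simp: facet_of_def edge_of_def)
  show "e edge_of T \<and> q \<in> e \<longleftrightarrow> e = T \<inter> perp_line q \<nu>"
    and "affine hull (T \<inter> perp_line q \<nu>) = perp_line q \<nu>"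
    using edge[OF Fe F(2)] edge[of e] Fe F(2) by metis+
qed

text \<open>An interior point \<open>z\<close> on the line would make the segments from \<open>z\<close> to \<open>a\<close> and to \<open>c\<close> interior except
  for their ends, and one of these segments passes through \<open>b\<close> unless \<open>z = b\<close>.\<close>

lemma chord_through_frontier_disjoint_interior:
  fixes T :: "'a::euclidean_space set"
  assumes "convex T" "a \<in> closure T" "c \<in> closure T" "b \<notin> interior T" "b \<in> open_segment a c"
  shows "affine hull {a, c} \<inter> interior T = {}"
proof (rule ccontr)
  assume "affine hull {a, c} \<inter> interior T \<noteq> {}"
  then obtain s where z: "a + s *\<^sub>R (c - a) \<in> interior T" (is "?z \<in> _")
    by (auto simp: affine_hull_2_alt)
  obtain t where t: "a \<noteq> c" "0 < t" "t < 1" "b = (1 - t) *\<^sub>R a + t *\<^sub>R c"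
    using assms(5) by (auto simp: in_segment)
  have seg: "open_segment ?z a \<subseteq> interior T" "open_segment ?z c \<subseteq> interior T"
    using in_interior_closure_convex_segment[OF assms(1) z] assms(2,3) by auto
  consider "s = t" | "t < s" | "s < t" by linarith
  then show False
  proof cases
    case 1
    then have "b = ?z" using t by (simp add: algebra_simps)
    then show ?thesis using z assms(4) by simp
  next
    case 2
    \<comment> \<open>the parameter that takes \<open>s\<close> to \<open>t\<close> on the way from \<open>s\<close> to \<open>0\<close>\<close>
    have "b = (1 - (1 - t/s)) *\<^sub>R ?z + (1 - t/s) *\<^sub>R a"
      using 2 t by (simp add: algebra_simps)
    moreover have "?z \<noteq> a" "0 < 1 - t/s" "1 - t/s < 1" using 2 t by auto
    ultimately have "b \<in> open_segment ?z a" unfolding in_segment by blast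
    then show ?thesis using seg assms(4) by blast
  next
    case 3
    \<comment> \<open>the parameter that takes \<open>s\<close> to \<open>t\<close> on the way from \<open>s\<close> to \<open>1\<close>\<close>
    define k where "k = (t - s)/(1 - s)"
    have k: "k * (1 - s) = t - s" using 3 t by (simp add: k_def)
    have "0 < k" "k < 1" using 3 t by (auto simp: k_def)
    moreover have "b = (1 - k) *\<^sub>R ?z + k *\<^sub>R c"
    proof -
      have "(1 - k) *\<^sub>R ?z + k *\<^sub>R c = a + (s + k * (1 - s)) *\<^sub>R (c - a)"
        by (simp add: algebra_simps)
      also have "\<dots> = a + t *\<^sub>R (c - a)" by (simp add: k)
      also have "\<dots> = b" using t(4) by (simp add: algebra_simps)
      finally show ?thesis by (rule sym)
    qed
    moreover have "?z \<noteq> c"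
    proof
      assume "?z = c"
      then have "(s - 1) *\<^sub>R (c - a) = 0" by (simp add: algebra_simps)
      then show False using 3 t by auto
    qed
    ultimately have "b \<in> open_segment ?z c" unfolding in_segment by blast
    then show ?thesis using seg assms(4) by blast
  qed
qed

text \<open>Two supporting lines would pass through \<open>p\<close>: the line of the chord from \<open>p\<close> to \<open>r\<close>, and its
  perpendicular at \<open>p\<close>, since both rays leave \<open>p\<close> in the same direction.\<close>

lemma smooth_point_not_between:
  assumes T: "convex T" and p: "smooth_point T p"
    and sup: "outward_support_vector T p (bounce_normal p q r)"
    and fr: "q \<in> frontier T" "r \<in> frontier T"
  shows "q \<notin> open_segment p r"
proof
  assume q: "q \<in> open_segment p r"
  then obtain t where t: "p \<noteq> r" "0 < t" "t < 1" "q = (1 - t) *\<^sub>R p + t *\<^sub>R r"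
    by (auto simp: in_segment)
  have pq: "p - q = t *\<^sub>R (p - r)" using t(4) by (simp add: algebra_simps)
  have bn: "bounce_normal p q r = (2 / norm (p - r)) *\<^sub>R (p - r)"
    unfolding bounce_normal_def pq using t by (simp add: divide_inverse scaleR_2 flip: scaleR_add_left)
  then have nz: "bounce_normal p q r \<noteq> 0" using t(1) by simp
  have "p \<in> closure T" "r \<in> closure T" "q \<notin> interior T"
    using p fr by (auto simp: smooth_point_def frontier_def)
  from chord_through_frontier_disjoint_interior[OF T this q]
  have "affine hull {p, r} \<inter> interior T = {}" .
  moreover have "is_line (affine hull {p, r})"
    using t(1) by (simp add: is_line_def aff_dim_2)
  moreover have "p \<in> affine hull {p, r}" "r \<in> affine hull {p, r}" by (simp_all add: hull_inc)
  ultimately have "r \<in> perp_line p (bounce_normal p q r)"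
    using smooth_point_line_eq[OF p sup nz] by metis
  then have "(r - p) \<bullet> (p - r) = 0" using t(1) by (simp add: perp_line_def bn)
  then have "(p - r) \<bullet> (p - r) = 0" by (simp add: inner_diff_left inner_diff_right algebra_simps)
  then show False using t(1) by simp
qed

section \<open>The excentral triangle\<close>

lemma strict_triangle_inequality:
  fixes p q r :: "'a::euclidean_space"
  assumes "\<not> collinear {p, q, r}"
  shows "dist q r < dist p q + dist p r"
proof -
  have "\<not> between (q, r) p" using assms collinear_between_cases by blast
  then show ?thesis
    using dist_triangle[of q r p] by (simp add: between dist_commute)
qed

lemma scaled_bounce_normal:
  assumes "p \<noteq> q" "p \<noteq> r"
  shows "(dist p q * dist p r) *\<^sub>R bounce_normal p q r
      = dist p r *\<^sub>R (p - q) + dist p q *\<^sub>R (p - r)"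
proof -
  have "(c * d) *\<^sub>R (u /\<^sub>R c + v /\<^sub>R d) = d *\<^sub>R u + c *\<^sub>R v" if "c \<noteq> 0" "d \<noteq> 0"
    for c d :: real and u v :: "real^2"
  proof -
    have "c * d * inverse c = d" "c * d * inverse d = c" using that by (simp_all add: field_simps)
    then show ?thesis by (simp only: scaleR_add_right scaleR_scaleR)
  qed
  from this[of "norm (p - q)" "norm (p - r)" "p - q" "p - r"] show ?thesis
    using assms by (simp add: bounce_normal_def dist_norm)
qed

lemma scaled_excenter:
  assumes "\<not> collinear {p, q, r}"
  shows "dist p r + dist p q - dist q r > 0"
    and "(dist p r + dist p q - dist q r) *\<^sub>R excenter p q r
      = dist p r *\<^sub>R q + dist p q *\<^sub>R r - dist q r *\<^sub>R p"
  using strict_triangle_inequality[OF assms] by (simp_all add: excenter_def)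

lemma collinear_if_multiple:
  fixes p q r :: "'a::euclidean_space"
  assumes "r - p = t *\<^sub>R (q - p)"
  shows "collinear {p, q, r}"
proof -
  have "r = p + t *\<^sub>R (q - p)" using assms by (simp add: algebra_simps)
  then have "r \<in> affine hull {p, q}" by (auto simp: affine_hull_2_alt)
  then show ?thesis by (rule affine_hull_3_imp_collinear)
qed

lemma bounce_normal_nonzero:
  assumes "\<not> collinear {p, q, r}"
  shows "bounce_normal p q r \<noteq> 0"
proof
  assume 0: "bounce_normal p q r = 0"
  have ne: "p \<noteq> q" "p \<noteq> r" using assms by (auto simp: insert_commute)
  have "dist p q *\<^sub>R (r - p) = - dist p r *\<^sub>R (q - p)"
    using scaled_bounce_normal[OF ne] 0 by (simp add: algebra_simps)
  then have "r - p = (- dist p r / dist p q) *\<^sub>R (q - p)"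
    using ne by (simp only: eq_vector_fraction_iff) simp
  then show False using assms collinear_if_multiple by blast
qed

text \<open>The excenter opposite \<open>p\<close> lies on the interior bisector at \<open>p\<close>, on the side of \<open>q\<close> and \<open>r\<close>.\<close>

lemma excenter_minus_vertex:
  assumes "\<not> collinear {p, q, r}"
  shows "\<exists>k>0. excenter p q r - p = - k *\<^sub>R bounce_normal p q r"
proof -
  have ne: "p \<noteq> q" "p \<noteq> r" using assms by (auto simp: insert_commute)
  note d = scaled_excenter[OF assms]
  let ?k = "dist p q * dist p r / (dist p r + dist p q - dist q r)"
  have "(dist p r + dist p q - dist q r) *\<^sub>R (excenter p q r - p)
      = - (dist p q * dist p r) *\<^sub>R bounce_normal p q r"
    unfolding scaleR_minus_left scaled_bounce_normal[OF ne] scaleR_diff_right d(2)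
    by (simp add: algebra_simps)
  then have "excenter p q r - p
      = (- (dist p q * dist p r) / (dist p r + dist p q - dist q r)) *\<^sub>R bounce_normal p q r"
    using d(1) by (simp only: eq_vector_fraction_iff) simp
  moreover have "?k > 0" using d(1) ne by simp
  ultimately show ?thesis by (intro exI[of _ ?k]) simp
qed

text \<open>With the unit vectors \<open>u, v\<close> from \<open>q\<close> and from \<open>r\<close> to \<open>p\<close>, the bounce vector is \<open>u + v\<close> and the
  excenter minus \<open>p\<close> is a multiple of \<open>u - v\<close>; these are orthogonal because \<open>u\<close> and \<open>v\<close> have the
  same length.\<close>

lemma excenter_mem_perp_line:
  assumes "\<not> collinear {p, q, r}"
  shows "excenter q r p \<in> perp_line p (bounce_normal p q r)"
proof -
  have ne: "p \<noteq> q" "p \<noteq> r" using assms by (auto simp: insert_commute)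
  let ?d = "dist q p + dist q r - dist r p"
  have "\<not> collinear {q, r, p}" using assms by (simp add: insert_commute)
  note d = scaled_excenter[OF this]
  let ?u = "(p - q) /\<^sub>R norm (p - q)" and ?v = "(p - r) /\<^sub>R norm (p - r)"
  have "?d *\<^sub>R (excenter q r p - p) = dist p r *\<^sub>R (p - q) - dist p q *\<^sub>R (p - r)"
    unfolding scaleR_diff_right d(2) by (simp add: algebra_simps dist_commute)
  also have "\<dots> = (dist p q * dist p r) *\<^sub>R (?u - ?v)"
  proof -
    have "dist p q * dist p r * inverse (norm (p - q)) = dist p r"
      "dist p q * dist p r * inverse (norm (p - r)) = dist p q"
      using ne by (simp_all add: dist_norm field_simps)
    then show ?thesis by (simp only: scaleR_diff_right scaleR_scaleR)
  qed
  finally have "?d * ((excenter q r p - p) \<bullet> (?u + ?v))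
      = dist p q * dist p r * ((?u - ?v) \<bullet> (?u + ?v))"
    by (metis inner_scaleR_left)
  moreover have "(u - v) \<bullet> (u + v) = u \<bullet> u - v \<bullet> v" for u v :: "real^2"
    by (simp add: inner_diff_left inner_diff_right inner_add_right inner_commute)
  note this[of ?u ?v]
  moreover have "?u \<bullet> ?u = 1" "?v \<bullet> ?v = 1"
    using ne by (simp_all add: dot_square_norm power2_eq_square)
  ultimately show ?thesis
    using d(1) by (simp add: perp_line_def bounce_normal_def)
qed

text \<open>In the weighted sum \<open>(a - b + c) B + (a + b - c) C\<close> of the two excenters the terms with \<open>q\<close> and
  \<open>r\<close> cancel and \<open>2 a p\<close> remains.  The weights are positive by the strict triangle inequality.\<close>

lemma vertex_between_excenters:
  assumes "\<not> collinear {p, q, r}"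
  shows "p \<in> open_segment (excenter q r p) (excenter r p q)"
proof -
  let ?a = "dist q r" and ?b = "dist p r" and ?c = "dist p q"
  let ?B = "excenter q r p" and ?C = "excenter r p q"
  have ne: "q \<noteq> r" using assms by auto
  have dB: "?c + ?a - ?b > 0" and dC: "?a + ?b - ?c > 0"
    using strict_triangle_inequality[of q p r] strict_triangle_inequality[of r q p] assms
    by (simp_all add: insert_commute dist_commute)
  have B: "(?c + ?a - ?b) *\<^sub>R ?B = ?c *\<^sub>R r + ?a *\<^sub>R p - ?b *\<^sub>R q"
    using dB by (simp add: excenter_def dist_commute)
  have C: "(?a + ?b - ?c) *\<^sub>R ?C = ?a *\<^sub>R p + ?b *\<^sub>R q - ?c *\<^sub>R r"
    using dC by (simp add: excenter_def dist_commute)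
  \<comment> \<open>the weight of \<open>C\<close>, normalised by the sum \<open>2 a\<close> of the weights\<close>
  define t where "t = (?a + ?b - ?c) / (2 * ?a)"
  have t: "2 * ?a * t = ?a + ?b - ?c" "2 * ?a * (1 - t) = ?c + ?a - ?b"
    using ne by (simp_all add: t_def field_simps)
  have "0 < t" "0 < 1 - t" using dB dC ne by (simp_all add: t_def field_simps)
  moreover have "p = (1 - t) *\<^sub>R ?B + t *\<^sub>R ?C"
  proof -
    have "(2 * ?a) *\<^sub>R ((1 - t) *\<^sub>R ?B + t *\<^sub>R ?C)
        = (?c + ?a - ?b) *\<^sub>R ?B + (?a + ?b - ?c) *\<^sub>R ?C"
      by (simp only: scaleR_add_right scaleR_scaleR t)
    also have "\<dots> = (2 * ?a) *\<^sub>R p"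
      unfolding B C by (simp add: scaleR_2 flip: scaleR_scaleR)
    finally show ?thesis using ne by simp
  qed
  moreover have "?B \<noteq> ?C"
  \<comment> \<open>otherwise both equal \<open>p\<close>, and \<open>r - p\<close> is a multiple of \<open>q - p\<close>\<close>
  proof
    assume "?B = ?C"
    then have eq: "p = ?B" using calculation(3) by (simp flip: scaleR_add_left)
    with B have "(?c - ?b) *\<^sub>R p = ?c *\<^sub>R r - ?b *\<^sub>R q"
      by (simp add: algebra_simps)
    then have "?c *\<^sub>R (r - p) = ?b *\<^sub>R (q - p)" by (simp add: algebra_simps)
    moreover have "?c \<noteq> 0" using assms by auto
    ultimately have "r - p = (?b / ?c) *\<^sub>R (q - p)"
      by (simp add: eq_vector_fraction_iff)
    then show False using assms collinear_if_multiple by blast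
  qed
  ultimately show ?thesis unfolding in_segment by (metis diff_gt_0_iff_gt)
qed

section \<open>The triangle cut out by three lines\<close>

text \<open>The vertices \<open>B, C\<close> lie on the line through \<open>p\<close> with normal \<open>l\<close>, the vertex \<open>A\<close> strictly on its
  negative side, and cyclically.  Then the affine function \<open>x \<mapsto> (x - p) \<bullet> l\<close> is a negative multiple
  of the barycentric coordinate of \<open>A\<close>, so lines and half-planes can be read off the coordinates.\<close>

context
  fixes A B C p q r l m n :: "real^2"
  assumes l: "B \<in> perp_line p l" "C \<in> perp_line p l" "(A - p) \<bullet> l < 0"
    and m: "C \<in> perp_line q m" "A \<in> perp_line q m" "(B - q) \<bullet> m < 0"
    and n: "A \<in> perp_line r n" "B \<in> perp_line r n" "(C - r) \<bullet> n < 0"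
begin

lemma cut_out_not_collinear: "\<not> collinear {A, B, C}"
proof
  assume "collinear {A, B, C}"
  then have "collinear {B, C, A}" by (simp add: insert_commute)
  moreover have "B \<noteq> C" using m by (auto simp: perp_line_def)
  ultimately have "A \<in> affine hull {B, C}" using collinear_3_affine_hull by blast
  then obtain u v where "u + v = 1" "A = u *\<^sub>R B + v *\<^sub>R C" by (auto simp: affine_hull_2)
  moreover from this have "A - p = u *\<^sub>R (B - p) + v *\<^sub>R (C - p)"
    by (simp add: algebra_simps flip: scaleR_add_left)
  ultimately have "(A - p) \<bullet> l = u * ((B - p) \<bullet> l) + v * ((C - p) \<bullet> l)"
    by (simp add: inner_add_left)
  then show False using l by (simp add: perp_line_def)
qed

lemma barycentric_coordinates:
  obtains u v w where "u + v + w = 1" "x = u *\<^sub>R A + v *\<^sub>R B + w *\<^sub>R C"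
    "(x - p) \<bullet> l = u * ((A - p) \<bullet> l)" "(x - q) \<bullet> m = v * ((B - q) \<bullet> m)"
    "(x - r) \<bullet> n = w * ((C - r) \<bullet> n)"
proof -
  have "\<not> affine_dependent {A, B, C}" "card {A, B, C} = 3"
    using cut_out_not_collinear collinear_3_eq_affine_dependent by (auto simp: card_insert_if)
  then have "aff_dim {A, B, C} = 2" using aff_dim_affine_independent by fastforce
  then have "affine hull {A, B, C} = UNIV"
    using aff_dim_eq_full[of "{A, B, C}"] by simp
  then have "x \<in> affine hull {A, B, C}" by simp
  then obtain u v w where uvw: "u + v + w = 1" "x = u *\<^sub>R A + v *\<^sub>R B + w *\<^sub>R C"
    unfolding affine_hull_3 by blast
  have "x - z = u *\<^sub>R (A - z) + v *\<^sub>R (B - z) + w *\<^sub>R (C - z)" for z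
  proof -
    have "u *\<^sub>R (A - z) + v *\<^sub>R (B - z) + w *\<^sub>R (C - z) = x - (u + v + w) *\<^sub>R z"
      using uvw(2) by (simp add: algebra_simps)
    then show ?thesis using uvw(1) by simp
  qed
  then have "(x - z) \<bullet> y = u * ((A - z) \<bullet> y) + v * ((B - z) \<bullet> y) + w * ((C - z) \<bullet> y)" for y z
    by (simp add: inner_add_left)
  then show thesis using that[OF uvw] l m n by (simp add: perp_line_def)
qed

lemma cut_out_halfplanes:
  "{x. (x - p) \<bullet> l \<le> 0 \<and> (x - q) \<bullet> m \<le> 0 \<and> (x - r) \<bullet> n \<le> 0} \<subseteq> convex hull {A, B, C}"
proof
  fix x assume "x \<in> {x. (x - p) \<bullet> l \<le> 0 \<and> (x - q) \<bullet> m \<le> 0 \<and> (x - r) \<bullet> n \<le> 0}"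
  moreover obtain u v w where "u + v + w = 1" "x = u *\<^sub>R A + v *\<^sub>R B + w *\<^sub>R C"
    "(x - p) \<bullet> l = u * ((A - p) \<bullet> l)" "(x - q) \<bullet> m = v * ((B - q) \<bullet> m)"
    "(x - r) \<bullet> n = w * ((C - r) \<bullet> n)"
    by (rule barycentric_coordinates)
  moreover from calculation have "u \<ge> 0" "v \<ge> 0" "w \<ge> 0"
    using l m n by (auto simp: mult_le_0_iff)
  ultimately show "x \<in> convex hull {A, B, C}" unfolding convex_hull_3 by blast
qed

lemma lines_cut_out_vertices:
  "lines_cut_out_triangle (perp_line p l) (perp_line q m) (perp_line r n) A B C"
proof -
  have "x = A" if x: "x \<in> perp_line q m" "x \<in> perp_line r n" for x
  proof -
    obtain u v w where "u + v + w = 1" "x = u *\<^sub>R A + v *\<^sub>R B + w *\<^sub>R C"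
      "(x - q) \<bullet> m = v * ((B - q) \<bullet> m)" "(x - r) \<bullet> n = w * ((C - r) \<bullet> n)"
      by (rule barycentric_coordinates)
    then show ?thesis using x m n by (auto simp: perp_line_def)
  qed
  moreover have "x = B" if x: "x \<in> perp_line r n" "x \<in> perp_line p l" for x
  proof -
    obtain u v w where "u + v + w = 1" "x = u *\<^sub>R A + v *\<^sub>R B + w *\<^sub>R C"
      "(x - p) \<bullet> l = u * ((A - p) \<bullet> l)" "(x - r) \<bullet> n = w * ((C - r) \<bullet> n)"
      by (rule barycentric_coordinates)
    then show ?thesis using x l n by (auto simp: perp_line_def)
  qed
  moreover have "x = C" if x: "x \<in> perp_line p l" "x \<in> perp_line q m" for x
  proof -
    obtain u v w where "u + v + w = 1" "x = u *\<^sub>R A + v *\<^sub>R B + w *\<^sub>R C"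
      "(x - p) \<bullet> l = u * ((A - p) \<bullet> l)" "(x - q) \<bullet> m = v * ((B - q) \<bullet> m)"
      by (rule barycentric_coordinates)
    then show ?thesis using x l m by (auto simp: perp_line_def)
  qed
  ultimately show ?thesis
    unfolding lines_cut_out_triangle_def using cut_out_not_collinear l m n by blast
qed

text \<open>The edge of \<open>T\<close> lies in the side and spans the same line, so passing to relative interiors keeps the
  inclusion.  This is what excludes the vertices \<open>B\<close> and \<open>C\<close>.\<close>

lemma rel_interior_edge_subset_side:
  assumes T: "T \<subseteq> convex hull {A, B, C}"
    and hull: "affine hull (T \<inter> perp_line p l) = perp_line p l"
  shows "rel_interior (T \<inter> perp_line p l) \<subseteq> open_segment B C"
proof -
  have sub: "T \<inter> perp_line p l \<subseteq> closed_segment B C"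
  proof
    fix x assume x: "x \<in> T \<inter> perp_line p l"
    then obtain u v w where uvw: "u + v + w = 1" "x = u *\<^sub>R A + v *\<^sub>R B + w *\<^sub>R C"
        "u \<ge> 0" "v \<ge> 0" "w \<ge> 0"
      using T convex_hull_3[of A B C] by blast
    have "x - p = u *\<^sub>R (A - p) + v *\<^sub>R (B - p) + w *\<^sub>R (C - p) + (u + v + w - 1) *\<^sub>R p"
      using uvw(2) by (simp add: algebra_simps)
    then have "(x - p) \<bullet> l = u * ((A - p) \<bullet> l) + v * ((B - p) \<bullet> l) + w * ((C - p) \<bullet> l)"
      using uvw(1) by (simp add: inner_add_left)
    then have "u = 0" using x l by (simp add: perp_line_def)
    then show "x \<in> closed_segment B C"
      using uvw unfolding closed_segment_def by (auto intro!: exI[of _ w])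
  qed
  have "closed_segment B C \<subseteq> perp_line p l"
    using l closed_segment_subset[of B "perp_line p l" C] convex_hyperplane
    unfolding perp_line_alt by blast
  moreover have "affine (perp_line p l)" by (metis affine_affine_hull hull)
  ultimately have "affine hull (closed_segment B C) \<subseteq> perp_line p l" by (rule hull_minimal)
  then have "affine hull (T \<inter> perp_line p l) = affine hull (closed_segment B C)"
    using hull_mono[OF sub, of affine] hull by blast
  then have "rel_interior (T \<inter> perp_line p l) \<subseteq> rel_interior (closed_segment B C)"
    using rel_interior_mono[OF sub] by simp
  moreover have "B \<noteq> C" using m by (auto simp: perp_line_def)
  ultimately show ?thesis by (simp add: rel_interior_closed_segment)
qed

end

section \<open>Orientation\<close>

lemma signed_area2_nonzero:
  assumes "\<not> collinear {A, B, C}"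
  shows "signed_area2 A B C \<noteq> 0"
proof
  assume 0: "signed_area2 A B C = 0"
  have "(C - B) \<bullet> (C - B) \<noteq> 0" using assms by auto
  moreover have "((C - B) \<bullet> (C - B)) *\<^sub>R (A - B) = ((A - B) \<bullet> (C - B)) *\<^sub>R (C - B)"
  proof -
    let ?s = "signed_area2 A B C"
    \<comment> \<open>the component of \<open>A - B\<close> orthogonal to \<open>C - B\<close>, written with the quarter turn of \<open>C - B\<close>\<close>
    have "((C - B) \<bullet> (C - B)) *\<^sub>R (A - B) - ((A - B) \<bullet> (C - B)) *\<^sub>R (C - B)
        = ?s *\<^sub>R vector [- ((C - B)$2), (C - B)$1]"
      by (simp add: vec_eq_iff forall_2 inner_vec_def sum_2 signed_area2_def) algebra
    then show ?thesis using 0 by simp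
  qed
  ultimately have "A - B = (((A - B) \<bullet> (C - B)) / ((C - B) \<bullet> (C - B))) *\<^sub>R (C - B)"
    by (simp add: eq_vector_fraction_iff)
  then have "collinear {B, C, A}" by (rule collinear_if_multiple)
  then show False using assms by (simp add: insert_commute)
qed

lemma signed_area2_swap: "signed_area2 x z y = - signed_area2 x y z"
  by (simp add: signed_area2_def algebra_simps)

text \<open>The constant is the determinant of the barycentric coordinates of \<open>x, y, z\<close>: if these points
  divide their sides in the parameters \<open>r, s, t\<close>, it is \<open>r s t + (1 - r) (1 - s) (1 - t)\<close>.\<close>

lemma signed_area2_points_on_sides:
  assumes "x \<in> open_segment B C" "y \<in> open_segment C A" "z \<in> open_segment A B"
  shows "\<exists>k>0. signed_area2 x y z = k * signed_area2 A B C"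
proof -
  obtain r s t where rst:
    "0 < r" "r < 1" "x = (1 - r) *\<^sub>R B + r *\<^sub>R C"
    "0 < s" "s < 1" "y = (1 - s) *\<^sub>R C + s *\<^sub>R A"
    "0 < t" "t < 1" "z = (1 - t) *\<^sub>R A + t *\<^sub>R B"
    using assms unfolding in_segment by blast
  have "signed_area2 x y z = (r * s * t + (1 - r) * (1 - s) * (1 - t)) * signed_area2 A B C"
    unfolding rst(3,6,9) signed_area2_def vector_add_component vector_scaleR_component real_scaleR_def
    by (simp add: algebra_simps)
  with rst show ?thesis
    by (intro exI[of _ "r * s * t + (1 - r) * (1 - s) * (1 - t)"]) (simp add: add_pos_pos)
qed

section \<open>Altitudes\<close>

text \<open>Projecting \<open>Z\<close> orthogonally to the line \<open>X Y\<close> does not change the inner product with \<open>Y - X\<close>,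
  and the foot lies on the same side of \<open>X\<close> as \<open>Y\<close>.\<close>

lemma triangle_angle_acute:
  assumes "r \<in> open_segment X Y" "orthogonal (Z - r) (Y - X)"
  shows "triangle_angle Z X Y < pi / 2"
proof -
  obtain t where t: "X \<noteq> Y" "0 < t" "r = (1 - t) *\<^sub>R X + t *\<^sub>R Y"
    using assms(1) by (auto simp: in_segment)
  have "Z - X = (Z - r) + t *\<^sub>R (Y - X)" using t(3) by (simp add: algebra_simps)
  then have "(Z - X) \<bullet> (Y - X) = (Z - r) \<bullet> (Y - X) + t * ((Y - X) \<bullet> (Y - X))"
    by (metis inner_add_left inner_scaleR_left)
  then have pos: "(Z - X) \<bullet> (Y - X) > 0" using assms(2) t by (simp add: orthogonal_def)
  then have "norm (Z - X) * norm (Y - X) > 0" by (intro mult_pos_pos) (use t(1) in auto)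
  then have "0 < (Z - X) \<bullet> (Y - X) / (norm (Z - X) * norm (Y - X))"
    "(Z - X) \<bullet> (Y - X) / (norm (Z - X) * norm (Y - X)) \<le> 1"
    using pos norm_cauchy_schwarz[of "Z - X" "Y - X"] by (auto simp: divide_le_eq_1)
  then show ?thesis
    unfolding triangle_angle_def using arccos_less_arccos[of 0] arccos_0 by fastforce
qed

lemma altitude_foot_eqI:
  assumes "p \<in> open_segment B C" "orthogonal (A - p) (C - B)"
  shows "altitude_foot A B C = p"
proof -
  have "B \<noteq> C" using assms(1) by auto
  moreover have "p \<in> affine hull {B, C}"
    using assms(1) convex_hull_subset_affine_hull[of "{B, C}"]
    by (auto simp: open_segment_def segment_convex_hull)
  ultimately show ?thesis
    unfolding altitude_foot_def using altitude_foot_ex1[of B C A] assms(2) by (intro the1_equality) auto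
qed

section \<open>Three-bounce orbits\<close>

text \<open>The vertices are the excenters opposite \<open>p\<close>, \<open>q\<close> and \<open>r\<close>, in this order.  The last three properties
  locate the edges of \<open>T\<close> on the sides of the triangle, as orientation requires.\<close>

lemma excentral_triangle:
  assumes nc: "\<not> collinear {p, q, r}"
    and T: "outward_support_vector T p (bounce_normal p q r)"
      "outward_support_vector T q (bounce_normal q r p)"
      "outward_support_vector T r (bounce_normal r p q)"
  obtains A B C where
    "lines_cut_out_triangle (perp_line p (bounce_normal p q r)) (perp_line q (bounce_normal q r p))
       (perp_line r (bounce_normal r p q)) A B C"
    "acute_triangle A B C" "T \<subseteq> convex hull {A, B, C}"
    "fagnano_triangle A B C = closed_segment p q \<union> closed_segment q r \<union> closed_segment r p"
    "affine hull (T \<inter> perp_line p (bounce_normal p q r)) = perp_line p (bounce_normal p q r)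
      \<Longrightarrow> rel_interior (T \<inter> perp_line p (bounce_normal p q r)) \<subseteq> open_segment B C"
    "affine hull (T \<inter> perp_line q (bounce_normal q r p)) = perp_line q (bounce_normal q r p)
      \<Longrightarrow> rel_interior (T \<inter> perp_line q (bounce_normal q r p)) \<subseteq> open_segment C A"
    "affine hull (T \<inter> perp_line r (bounce_normal r p q)) = perp_line r (bounce_normal r p q)
      \<Longrightarrow> rel_interior (T \<inter> perp_line r (bounce_normal r p q)) \<subseteq> open_segment A B"
proof -
  let ?l = "bounce_normal p q r" and ?m = "bounce_normal q r p" and ?n = "bounce_normal r p q"
  let ?A = "excenter p q r" and ?B = "excenter q r p" and ?C = "excenter r p q"
  \<comment> \<open>stated for an arbitrary triple, to be used for the three cyclic rotations of \<open>p, q, r\<close>\<close>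
  have data: "excenter y z x \<in> perp_line x (bounce_normal x y z) \<and>
      excenter z x y \<in> perp_line x (bounce_normal x y z) \<and>
      (excenter x y z - x) \<bullet> bounce_normal x y z < 0 \<and>
      orthogonal (excenter x y z - x) (excenter z x y - excenter y z x) \<and>
      x \<in> open_segment (excenter y z x) (excenter z x y)"
    if nc: "\<not> collinear {x, y, z}" for x y z
  proof -
    have on: "excenter y z x \<in> perp_line x (bounce_normal x y z)"
      "excenter z x y \<in> perp_line x (bounce_normal x y z)"
      using excenter_mem_perp_line[of x y z] excenter_mem_perp_line[of x z y] nc
      by (simp_all add: insert_commute excenter_commute[of z x y] bounce_normal_commute[of x z y])
    obtain k where k: "k > 0" "excenter x y z - x = - k *\<^sub>R bounce_normal x y z"
      using excenter_minus_vertex[OF nc] by blast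
    have neg: "(excenter x y z - x) \<bullet> bounce_normal x y z < 0"
      using k bounce_normal_nonzero[OF nc] by simp
    have "bounce_normal x y z \<bullet> (excenter z x y - excenter y z x) = 0"
      using on by (simp add: perp_line_alt inner_diff_right)
    then have "orthogonal (excenter x y z - x) (excenter z x y - excenter y z x)"
      unfolding k(2) orthogonal_def by simp
    with on neg vertex_between_excenters[OF nc] show ?thesis by blast
  qed
  have nc': "\<not> collinear {q, r, p}" "\<not> collinear {r, p, q}"
    using nc by (simp_all add: insert_commute)
  note P = data[OF nc] and Q = data[OF nc'(1)] and R = data[OF nc'(2)]
  note l = P[THEN conjunct1] P[THEN conjunct2, THEN conjunct1] P[THEN conjunct2, THEN conjunct2, THEN conjunct1]
  note m = Q[THEN conjunct1] Q[THEN conjunct2, THEN conjunct1] Q[THEN conjunct2, THEN conjunct2, THEN conjunct1]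
  note n = R[THEN conjunct1] R[THEN conjunct2, THEN conjunct1] R[THEN conjunct2, THEN conjunct2, THEN conjunct1]
  have hull: "T \<subseteq> convex hull {?A, ?B, ?C}"
    using cut_out_halfplanes[OF l m n] T unfolding outward_support_vector_def by blast
  show thesis
  proof (rule that)
    show "lines_cut_out_triangle (perp_line p ?l) (perp_line q ?m) (perp_line r ?n) ?A ?B ?C"
      by (rule lines_cut_out_vertices[OF l m n])
    show "acute_triangle ?A ?B ?C"
      unfolding acute_triangle_def
      using cut_out_not_collinear[OF l m n] triangle_angle_acute P Q R by blast
    show "T \<subseteq> convex hull {?A, ?B, ?C}" by (fact hull)
    have "altitude_foot ?A ?B ?C = p" "altitude_foot ?B ?C ?A = q" "altitude_foot ?C ?A ?B = r"
      using altitude_foot_eqI P Q R by blast+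
    then show "fagnano_triangle ?A ?B ?C
        = closed_segment p q \<union> closed_segment q r \<union> closed_segment r p"
      by (simp add: fagnano_triangle_def)
    have hull': "T \<subseteq> convex hull {?B, ?C, ?A}" "T \<subseteq> convex hull {?C, ?A, ?B}"
      using hull by (simp_all add: insert_commute)
    show "rel_interior (T \<inter> perp_line p ?l) \<subseteq> open_segment ?B ?C"
      if "affine hull (T \<inter> perp_line p ?l) = perp_line p ?l"
      by (rule rel_interior_edge_subset_side[OF l m n hull that])
    show "rel_interior (T \<inter> perp_line q ?m) \<subseteq> open_segment ?C ?A"
      if "affine hull (T \<inter> perp_line q ?m) = perp_line q ?m"
      by (rule rel_interior_edge_subset_side[OF m n l hull'(1) that])
    show "rel_interior (T \<inter> perp_line r ?n) \<subseteq> open_segment ?A ?B"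
      if "affine hull (T \<inter> perp_line r ?n) = perp_line r ?n"
      by (rule rel_interior_edge_subset_side[OF n l m hull'(2) that])
  qed
qed

lemma three_periodic_cases:
  fixes q :: "int \<Rightarrow> 'a"
  assumes "\<And>i. q (i + 3) = q i"
  shows "(q i, q (i + 1)) \<in> {(q 0, q 1), (q 1, q 2), (q 2, q 0)}"
proof -
  have mult: "q (j + 3 * int k) = q j" for j k
  proof (induction k)
    case (Suc k)
    have "j + 3 * int (Suc k) = (j + 3 * int k) + 3" by simp
    then show ?case using Suc assms by metis
  qed simp
  have per: "q (j + 3 * k) = q j" for j k
    using mult[of j "nat k"] mult[of "j + 3 * k" "nat (- k)"] by (cases "k \<ge> 0") auto
  have "i mod 3 \<in> {0, 1, 2}" by auto
  moreover have "q i = q (i mod 3)" "q (i + 1) = q (i mod 3 + 1)"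
    using per[of "i mod 3" "i div 3"] per[of "i mod 3 + 1" "i div 3"]
    by (simp_all add: add.commute add.left_commute)
  moreover have "q 3 = q 0" using assms[of 0] by simp
  ultimately show ?thesis by auto
qed

lemma orbit_trace_three_periodic:
  assumes "\<And>i. q (i + 3) = q i"
  shows "orbit_trace q
    = closed_segment (q 0) (q 1) \<union> closed_segment (q 1) (q 2) \<union> closed_segment (q 2) (q 0)"
proof -
  let ?seg = "\<lambda>i. closed_segment (q i) (q (i + 1))"
  let ?S = "{closed_segment (q 0) (q 1), closed_segment (q 1) (q 2), closed_segment (q 2) (q 0)}"
  have "?seg i \<in> ?S" for i
    using three_periodic_cases[of q i, OF assms] by (elim insertE emptyE) simp_all
  then have "range ?seg \<subseteq> ?S"
    by (rule image_subsetI)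
  moreover have "?seg i \<in> range ?seg" for i
    by (rule rangeI)
  note this[of 0] this[of 1] this[of 2]
  then have "?S \<subseteq> range ?seg"
    using assms[of 0] by simp
  ultimately have "range ?seg = ?S"
    by (rule subset_antisym)
  then show ?thesis unfolding orbit_trace_def by (simp add: Un_assoc)
qed

lemma triple_permutations:
  assumes "{x, y, z} = {u, v, w}" "distinct [x, y, z]"
  shows "(x, y, z) \<in> {(u, v, w), (v, w, u), (w, u, v), (u, w, v), (w, v, u), (v, u, w)}"
proof -
  have "x \<in> {u, v, w}" "y \<in> {u, v, w}" "z \<in> {u, v, w}" using assms(1) by blast+
  then show ?thesis using assms(2) by auto
qed

theorem proposition2p3:
  fixes T :: "(real^2) set" and q :: "int \<Rightarrow> real^2"
  assumes "polytope T" and "interior T \<noteq> {}"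
    and "regular_billiard_orbit T q" and "bounce_orbit 3 T q"
  shows "(\<exists>e1 e2 e3. ccw_enumeration (edges_hit T q) e1 e2 e3) \<and>
    (\<forall>e1 e2 e3. ccw_enumeration (edges_hit T q) e1 e2 e3 \<longrightarrow>
      (\<exists>A B C. lines_cut_out_triangle (affine hull e1) (affine hull e2) (affine hull e3) A B C \<and>
         acute_triangle A B C \<and>
         T \<subseteq> convex hull {A, B, C} \<and>
         orbit_trace q = fagnano_triangle A B C))"
proof -
  define a b c where abc: "a = q 0" "b = q 1" "c = q 2"
  have per: "q (i + 3) = q i" for i
    using assms(4) by (simp add: bounce_orbit_def closes_after_def)
  have q3: "q 3 = a" "q (-1) = c" using per[of 0] per[of "-1"] abc by auto
  have cases: "(q i, q (i + 1)) \<in> {(a, b), (b, c), (c, a)}" for i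
    using three_periodic_cases[of q i] per abc by auto
  have orb: "q i \<noteq> q (i + 1)" "smooth_point T (q i)"
    "outward_support_vector T (q i) (bounce_normal (q i) (q (i + 1)) (q (i - 1)))" for i
    using assms(3) unfolding regular_billiard_orbit_def generalised_billiard_orbit_def
    by (auto simp: bounce_normal_def add.commute)
  have smooth: "smooth_point T a" "smooth_point T b" "smooth_point T c"
    using orb(2) abc by auto
  have sup: "outward_support_vector T a (bounce_normal a b c)"
    "outward_support_vector T b (bounce_normal b c a)"
    "outward_support_vector T c (bounce_normal c a b)"
    using orb(3)[of 0] orb(3)[of 1] orb(3)[of 2] abc q3
    by simp_all
  have neq: "a \<noteq> b" "b \<noteq> c" "c \<noteq> a"
    using orb(1)[of 0] orb(1)[of 1] orb(1)[of 2] abc q3 by auto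
  have trace: "orbit_trace q = closed_segment a b \<union> closed_segment b c \<union> closed_segment c a"
    using orbit_trace_three_periodic[of q] per abc by simp
  have nc: "\<not> collinear {a, b, c}"
  proof
    assume "collinear {a, b, c}"
    then have "a \<in> open_segment b c \<or> b \<in> open_segment c a \<or> c \<in> open_segment a b"
      using neq by (auto simp: collinear_between_cases between_mem_segment open_segment_def)
    moreover have "convex T" using assms(1) polytope_imp_convex by blast
    moreover have "a \<in> frontier T" "b \<in> frontier T" "c \<in> frontier T"
      using smooth by (simp_all add: smooth_point_def)
    ultimately show False
      using smooth sup smooth_point_not_between bounce_normal_commute by metis
  qed
  \<comment> \<open>the edge hit at \<open>x\<close>, with the neighbours \<open>y\<close> and \<open>z\<close> of \<open>x\<close> on the orbit\<close>
  define e where "e x y z = T \<inter> perp_line x (bounce_normal x y z)" for x y z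
  have e_commute: "e x y z = e x z y" for x y z
    by (simp add: e_def bounce_normal_commute)
  have nz: "bounce_normal a b c \<noteq> 0" "bounce_normal b c a \<noteq> 0" "bounce_normal c a b \<noteq> 0"
    using nc by (simp_all add: bounce_normal_nonzero insert_commute)
  note edge = smooth_point_edge[OF assms(1,2) smooth(1) sup(1) nz(1), folded e_def]
    smooth_point_edge[OF assms(1,2) smooth(2) sup(2) nz(2), folded e_def]
    smooth_point_edge[OF assms(1,2) smooth(3) sup(3) nz(3), folded e_def]
  have visited: "q i \<in> {a, b, c}" for i
    using cases[of i] by (elim insertE emptyE) simp_all
  have "(\<exists>i. q i \<in> f) \<longleftrightarrow> a \<in> f \<or> b \<in> f \<or> c \<in> f" for f
  proof
    assume "\<exists>i. q i \<in> f"
    then obtain i where "q i \<in> f" ..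
    then show "a \<in> f \<or> b \<in> f \<or> c \<in> f" using visited[of i] by auto
  next
    assume "a \<in> f \<or> b \<in> f \<or> c \<in> f"
    then show "\<exists>i. q i \<in> f" unfolding abc by blast
  qed
  then have "edges_hit T q
      = {f. (f edge_of T \<and> a \<in> f) \<or> (f edge_of T \<and> b \<in> f) \<or> (f edge_of T \<and> c \<in> f)}"
    by (simp only: edges_hit_def conj_disj_distribL)
  then have hit: "edges_hit T q = {e a b c, e b c a, e c a b}"
    by (simp only: edge(1,3,5)) blast
  \<comment> \<open>all that is used about the bounce points; it is kept by rotations and by a transposition, hence
    by all permutations, which allows for an arbitrary enumeration of the edges\<close>
  define good where "good x y z \<longleftrightarrow> \<not> collinear {x, y, z} \<and>
      outward_support_vector T x (bounce_normal x y z) \<and>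
      outward_support_vector T y (bounce_normal y z x) \<and>
      outward_support_vector T z (bounce_normal z x y) \<and>
      orbit_trace q = closed_segment x y \<union> closed_segment y z \<union> closed_segment z x \<and>
      affine hull e x y z = perp_line x (bounce_normal x y z) \<and>
      affine hull e y z x = perp_line y (bounce_normal y z x) \<and>
      affine hull e z x y = perp_line z (bounce_normal z x y)" for x y z
  have good: "good a b c"
    using nc sup trace edge(2,4,6) by (simp add: good_def)
  have good_rotate: "good y z x" if "good x y z" for x y z
  proof -
    have "{y, z, x} = {x, y, z}" by auto
    moreover have "closed_segment y z \<union> closed_segment z x \<union> closed_segment x y
        = closed_segment x y \<union> closed_segment y z \<union> closed_segment z x" by blast
    ultimately show ?thesis using that unfolding good_def by presburger
  qed
  have good_swap: "good x z y" if "good x y z" for x y z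
  proof -
    have "{x, z, y} = {x, y, z}" by auto
    moreover have "closed_segment x z \<union> closed_segment z y \<union> closed_segment y x
        = closed_segment x y \<union> closed_segment y z \<union> closed_segment z x"
      by (simp only: closed_segment_commute[of x z] closed_segment_commute[of z y]
          closed_segment_commute[of y x]) blast
    ultimately show ?thesis using that
      unfolding good_def e_commute[of x z y] e_commute[of y x z] e_commute[of z y x]
        bounce_normal_commute[of x z y] bounce_normal_commute[of y x z] bounce_normal_commute[of z y x]
      by presburger
  qed
  have core: "\<exists>A B C. lines_cut_out_triangle (affine hull e x y z) (affine hull e y z x)
        (affine hull e z x y) A B C \<and> acute_triangle A B C \<and> T \<subseteq> convex hull {A, B, C} \<and>
        orbit_trace q = fagnano_triangle A B C \<and>
        (\<forall>u\<in>rel_interior (e x y z). \<forall>v\<in>rel_interior (e y z x). \<forall>w\<in>rel_interior (e z x y).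
           \<exists>k>0. signed_area2 u v w = k * signed_area2 A B C)"
    if "good x y z" for x y z
  proof -
    have xyz: "\<not> collinear {x, y, z}" "outward_support_vector T x (bounce_normal x y z)"
      "outward_support_vector T y (bounce_normal y z x)"
      "outward_support_vector T z (bounce_normal z x y)"
      "orbit_trace q = closed_segment x y \<union> closed_segment y z \<union> closed_segment z x"
      using that unfolding good_def by blast+
    have hull: "affine hull (T \<inter> perp_line x (bounce_normal x y z)) = perp_line x (bounce_normal x y z)"
      "affine hull (T \<inter> perp_line y (bounce_normal y z x)) = perp_line y (bounce_normal y z x)"
      "affine hull (T \<inter> perp_line z (bounce_normal z x y)) = perp_line z (bounce_normal z x y)"
      using that unfolding good_def e_def by blast+
    show ?thesis
      unfolding e_def hull xyz(5)
    proof (rule excentral_triangle[OF xyz(1-4)], goal_cases)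
      case (1 A B C)
      have "\<exists>k>0. signed_area2 u v w = k * signed_area2 A B C"
        if "u \<in> rel_interior (T \<inter> perp_line x (bounce_normal x y z))"
          "v \<in> rel_interior (T \<inter> perp_line y (bounce_normal y z x))"
          "w \<in> rel_interior (T \<inter> perp_line z (bounce_normal z x y))" for u v w
        using that signed_area2_points_on_sides 1(5)[OF hull(1)] 1(6)[OF hull(2)] 1(7)[OF hull(3)]
        by blast
      then show ?case using 1(1-4) by metis
    qed
  qed
  from core[OF good] obtain A B C where
    ABC: "lines_cut_out_triangle (affine hull e a b c) (affine hull e b c a) (affine hull e c a b) A B C"
    and area: "\<And>u v w. u \<in> rel_interior (e a b c) \<Longrightarrow> v \<in> rel_interior (e b c a) \<Longrightarrow>
      w \<in> rel_interior (e c a b) \<Longrightarrow> \<exists>k>0. signed_area2 u v w = k * signed_area2 A B C"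
    by blast
  have ncABC: "\<not> collinear {A, B, C}" using ABC by (simp add: lines_cut_out_triangle_def)
  then have "A \<noteq> B" "B \<noteq> C" "C \<noteq> A" by (auto simp: insert_commute)
  \<comment> \<open>two equal edges would give two equal vertices\<close>
  then have dist: "distinct [e a b c, e b c a, e c a b]"
    using ABC unfolding lines_cut_out_triangle_def by auto
  have ex: "\<exists>e1 e2 e3. ccw_enumeration (edges_hit T q) e1 e2 e3"
  proof (cases "signed_area2 A B C > 0")
    case True
    then have "ccw_enumeration (edges_hit T q) (e a b c) (e b c a) (e c a b)"
      using dist area unfolding ccw_enumeration_def hit by (metis mult_pos_pos)
    then show ?thesis by blast
  next
    case False
    then have "signed_area2 A B C < 0" using signed_area2_nonzero[OF ncABC] by linarith
    then have "signed_area2 u w v > 0" if "u \<in> rel_interior (e a b c)"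
      "v \<in> rel_interior (e b c a)" "w \<in> rel_interior (e c a b)" for u v w
      using area[OF that] signed_area2_swap[of u w v] by (auto simp: mult_pos_neg)
    then have "ccw_enumeration (edges_hit T q) (e a b c) (e c a b) (e b c a)"
      using dist unfolding ccw_enumeration_def hit by auto
    then show ?thesis by blast
  qed
  have "\<exists>A B C. lines_cut_out_triangle (affine hull e1) (affine hull e2) (affine hull e3) A B C \<and>
      acute_triangle A B C \<and> T \<subseteq> convex hull {A, B, C} \<and> orbit_trace q = fagnano_triangle A B C"
    if "ccw_enumeration (edges_hit T q) e1 e2 e3" for e1 e2 e3
  proof -
    have "{e1, e2, e3} = {e a b c, e b c a, e c a b}" "distinct [e1, e2, e3]"
      using that hit by (simp_all add: ccw_enumeration_def)
    then have "(e1, e2, e3) \<in> {(e a b c, e b c a, e c a b), (e b c a, e c a b, e a b c),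
        (e c a b, e a b c, e b c a), (e a c b, e c b a, e b a c), (e c b a, e b a c, e a c b),
        (e b a c, e a c b, e c b a)}"
      unfolding e_commute[of a c b] e_commute[of c b a] e_commute[of b a c]
      by (rule triple_permutations)
    then obtain x y z where
      xyz: "(x, y, z) \<in> {(a, b, c), (b, c, a), (c, a, b), (a, c, b), (c, b, a), (b, a, c)}"
      and e: "e1 = e x y z" "e2 = e y z x" "e3 = e z x y"
      by blast
    have "good x y z"
      using xyz by (elim insertE emptyE) (simp_all add: good good_rotate good_swap)
    from core[OF this] show ?thesis unfolding e by blast
  qed
  with ex show ?thesis by blast
qed

end
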